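(* Let $g:\mathbb{R}^n\to\mathbb{R}$ be continuously differentiable, let $h:\mathbb{R}^n\to\mathbb{R}\cup\{+\infty\}$ be proper, lower semicontinuous and prox-bounded with threshold $\gamma_h\in(0,+\infty]$, set $\varphi:=g+h$, and assume $\operatorname{argmin}\varphi\neq\emptyset$. For $0<\mu<\lambda<\gamma_h$ let $\varphi_{\lambda,\mu}:=g+h^{\lambda,\mu}$, where $h^{\lambda,\mu}$ is the Lasry--Lions double envelope of $h$. Suppose that there exist $0<\bar\mu<\bar\lambda<\gamma_h$ such that $\varphi_{\bar\lambda,\bar\mu}$ is level bounded. Let $(\lambda_k)_k$ and $(\mu_k)_k$ be sequences of strictly positive reals satisfying, for all $k$, $\lambda_k\le\bar\lambda$, $\mu_k<\lambda_k$ and $\mu_k\le\bar\mu$, with $\lambda_k\to0$ and with $\lambda_k-\mu_k$ decreasing monotonically to $0$. Then: 1. $\min\varphi_{\lambda_k,\mu_k}\to\min\varphi$ as $k\to\infty$; 2. for any sequence $\varepsilon_k\to0$ of nonnegative reals, any sequence $(x_\star^k)_k$ with $x_\star^k\in\varepsilon_k\text{-}\operatorname{argmin}\varphi_{\lambda_k,\mu_k}$ for all $k$ is bounded and has all its cluster points in $\operatorname{argmin}\varphi$.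
   Context: $\|\cdot\|$ is the Euclidean norm on $\mathbb{R}^n$. A function $h:\mathbb{R}^n\to\mathbb{R}\cup\{+\infty\}$ is proper if it is not identically $+\infty$. It is prox-bounded if $h+\frac{1}{2\gamma}\|\cdot\|^2$ is bounded below on $\mathbb{R}^n$ for some $\gamma>0$; the supremum $\gamma_h\in(0,+\infty]$ of all such $\gamma$ is its prox-boundedness threshold. For $\lambda>0$ the $\lambda$-Moreau envelope of $h$ is $h^{\lambda}(x):=\inf_w\{h(w)+\frac{1}{2\lambda}\|w-x\|^2\}$. For $\lambda>\mu>0$ the $(\lambda,\mu)$-Lasry--Lions double envelope of $h$ is $$h^{\lambda,\mu}(x):=-(-h^{\lambda})^{\mu}(x)=\sup_w\Big\{h^{\lambda}(w)-\tfrac{1}{2\mu}\|w-x\|^2\Big\}.$$ A function $f$ is level bounded if $\{x: f(x)\le\alpha\}$ is bounded for every $\alpha\in\mathbb{R}$. For $\varepsilon\ge0$, $\varepsilon\text{-}\operatorname{argmin} f:=\{x: f(x)\le\inf f+\varepsilon\}$. $\min f$ denotes the minimum value (attained infimum) of $f$; the convergence statement for $\min\varphi_{\lambda_k,\mu_k}$ concerns all sufficiently large $k$. *)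

theory Defs
  imports "HOL-Analysis.Analysis"
begin

text \<open>
  Extended-real-valued functions have codomain \<open>ereal\<close>. A function into
  \<open>\<real> \<union> {+\<infinity>}\<close> is one that never takes the value \<open>-\<infinity>\<close>.
\<close>

definition continuously_differentiable :: "('a::real_normed_vector \<Rightarrow> real) \<Rightarrow> bool" where
  "continuously_differentiable g \<longleftrightarrow>
    (\<exists>g' :: 'a \<Rightarrow> 'a \<Rightarrow>\<^sub>L real.
      (\<forall>x. (g has_derivative blinfun_apply (g' x)) (at x)) \<and> continuous_on UNIV g')"

definition proper_fun :: "('a \<Rightarrow> ereal) \<Rightarrow> bool" where
  "proper_fun h \<longleftrightarrow> (\<forall>x. h x \<noteq> -\<infinity>) \<and> (\<exists>x. h x \<noteq> \<infinity>)"

definition lower_semicontinuous :: "('a::topological_space \<Rightarrow> ereal) \<Rightarrow> bool" where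
  "lower_semicontinuous h \<longleftrightarrow> (\<forall>x. h x \<le> Liminf (at x) h)"

definition prox_bounded_with :: "('a::real_normed_vector \<Rightarrow> ereal) \<Rightarrow> real \<Rightarrow> bool" where
  "prox_bounded_with h \<gamma> \<longleftrightarrow>
    0 < \<gamma> \<and> (\<exists>m::real. \<forall>x. ereal m \<le> h x + ereal (1 / (2 * \<gamma>) * (norm x)\<^sup>2))"

definition prox_bounded :: "('a::real_normed_vector \<Rightarrow> ereal) \<Rightarrow> bool" where
  "prox_bounded h \<longleftrightarrow> (\<exists>\<gamma>. prox_bounded_with h \<gamma>)"

definition prox_threshold :: "('a::real_normed_vector \<Rightarrow> ereal) \<Rightarrow> ereal" where
  "prox_threshold h = Sup (ereal ` {\<gamma>. prox_bounded_with h \<gamma>})"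

definition moreau_envelope ::
  "real \<Rightarrow> ('a::real_normed_vector \<Rightarrow> ereal) \<Rightarrow> 'a \<Rightarrow> ereal" where
  "moreau_envelope lam h x = (INF w. h w + ereal (1 / (2 * lam) * (norm (w - x))\<^sup>2))"

definition lasry_lions ::
  "real \<Rightarrow> real \<Rightarrow> ('a::real_normed_vector \<Rightarrow> ereal) \<Rightarrow> 'a \<Rightarrow> ereal" where
  "lasry_lions lam mu h x = - moreau_envelope mu (\<lambda>w. - moreau_envelope lam h w) x"

lemma lasry_lions_eq_SUP:
  "lasry_lions lam mu h x =
    (SUP w. moreau_envelope lam h w - ereal (1 / (2 * mu) * (norm (w - x))\<^sup>2))"
proof -
  have *: "- (- a + ereal b) = a - ereal b" for a b
    by (cases a) auto
  show ?thesis
    unfolding lasry_lions_def moreau_envelope_def [of mu] ereal_INF_uminus_eq [symmetric]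
    by (simp add: ereal_SUP_uminus_eq [symmetric] *)
qed

definition level_bounded :: "('a::metric_space \<Rightarrow> ereal) \<Rightarrow> bool" where
  "level_bounded f \<longleftrightarrow> (\<forall>\<alpha>::real. bounded {x. f x \<le> ereal \<alpha>})"

definition argmin :: "('a \<Rightarrow> ereal) \<Rightarrow> 'a set" where
  "argmin f = {x. is_arg_min f (\<lambda>_. True) x}"

definition eps_argmin :: "real \<Rightarrow> ('a \<Rightarrow> ereal) \<Rightarrow> 'a set" where
  "eps_argmin \<epsilon> f = {x. f x \<le> (INF y. f y) + ereal \<epsilon>}"

definition seq_cluster_point :: "(nat \<Rightarrow> 'a::topological_space) \<Rightarrow> 'a \<Rightarrow> bool" where
  "seq_cluster_point X x \<longleftrightarrow> (\<exists>r::nat \<Rightarrow> nat. strict_mono r \<and> (X \<circ> r) \<longlonglongrightarrow> x)"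

end

theory Submission
  imports Defs
begin

text \<open>
  The double envelope is squeezed between two simpler functions,
  \<open>h\<^sup>\<lambda> \<le> h\<^sup>\<lambda>\<^sup>,\<^sup>\<mu> \<le> h\<close> whenever \<open>0 < \<mu> < \<lambda>\<close>. The upper bound keeps the infima of the
  smoothed problems below the infimum of \<open>\<phi>\<close>. The lower bound reduces the asymptotics to the
  Moreau envelope: if \<open>\<lambda> \<rightarrow> 0\<close> and \<open>y \<rightarrow> x\<close>, then \<open>liminf h\<^sup>\<lambda>(y) \<ge> h(x)\<close>, because near \<open>x\<close>
  lower semicontinuity bounds \<open>h\<close> from below, and far from \<open>x\<close> the penalty
  \<open>\<parallel>w - y\<parallel>\<^sup>2 / (2\<lambda>)\<close> eventually beats the quadratic minorant of \<open>h\<close> that prox-boundedness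
  provides (\<open>eventually_le_moreau_envelope\<close>).

  What remains is compactness, uniformly in \<open>k\<close>. It comes from a monotonicity property of the
  double envelope: it increases when \<open>\<lambda>\<close> and \<open>\<lambda> - \<mu>\<close> both decrease (\<open>lasry_lions_mono\<close>). Since
  \<open>\<lambda>\<^sub>k\<close> stays below its reference value and \<open>\<lambda>\<^sub>k - \<mu>\<^sub>k \<rightarrow> 0\<close>, all smoothed functions with \<open>k\<close> large lie above the level-bounded one, so
  near-minimizers stay in one bounded set. The direct method then does the rest
  (\<open>minimizing_sequence\<close>), and it is used three times: for the given near-minimizers, for exact
  minimizers, and, with a constant sequence of functions, for the existence of exact
  minimizers, as each smoothed function is itself lower semicontinuous (\<open>argmin_nonempty\<close>).
\<close>

section \<open>Moreau envelopes and Lasry--Lions double envelopes\<close>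

text \<open>
  Cauchy--Schwarz in Engel form; after clearing denominators the two sides differ by
  \<open>\<parallel>t a - s b\<parallel>\<^sup>2\<close>.
\<close>

lemma norm_add_sq_div_le:
  fixes a b :: "'a::real_inner"
  assumes "0 < s" "0 < t"
  shows "(norm (a + b))\<^sup>2 / (s + t) \<le> (norm a)\<^sup>2 / s + (norm b)\<^sup>2 / t"
proof -
  have "0 \<le> (norm (t *\<^sub>R a - s *\<^sub>R b))\<^sup>2"
    by simp
  also have "\<dots> = t\<^sup>2 * (a \<bullet> a) - 2 * s * t * (a \<bullet> b) + s\<^sup>2 * (b \<bullet> b)"
    unfolding power2_norm_eq_inner
    by (simp add: inner_diff_left inner_diff_right inner_commute[of b a] power2_eq_square algebra_simps)
  finally have "s * t * ((a + b) \<bullet> (a + b)) \<le> (s + t) * (t * (a \<bullet> a) + s * (b \<bullet> b))"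
    by (simp add: inner_add inner_commute power2_eq_square algebra_simps)
  then show ?thesis
    using assms by (simp add: power2_norm_eq_inner field_simps)
qed

lemma moreau_envelope_le:
  "moreau_envelope l h x \<le> h w + ereal (1 / (2 * l) * (norm (w - x))\<^sup>2)"
  unfolding moreau_envelope_def by (rule INF_lower) simp

text \<open>Choose the centre \<open>x\<close> itself in the outer supremum.\<close>

lemma moreau_envelope_le_lasry_lions: "moreau_envelope l h x \<le> lasry_lions l m h x"
  unfolding lasry_lions_eq_SUP by (rule SUP_upper2[of x]) auto

lemma lasry_lions_le:
  assumes "0 < m" "m < l"
  shows "lasry_lions l m h x \<le> h x"
  unfolding lasry_lions_eq_SUP
proof (rule SUP_least)
  fix w
  have "1 / (2 * l) * (norm (x - w))\<^sup>2 \<le> 1 / (2 * m) * (norm (w - x))\<^sup>2"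
    using assms by (intro mult_mono) (auto simp: norm_minus_commute frac_le)
  then have "h x + ereal (1 / (2 * l) * (norm (x - w))\<^sup>2)
      \<le> h x + ereal (1 / (2 * m) * (norm (w - x))\<^sup>2)"
    by (intro add_left_mono) simp
  with moreau_envelope_le[of l h w x]
  have "moreau_envelope l h w \<le> h x + ereal (1 / (2 * m) * (norm (w - x))\<^sup>2)"
    by (rule order_trans)
  then show "moreau_envelope l h w - ereal (1 / (2 * m) * (norm (w - x))\<^sup>2) \<le> h x"
    by (simp add: ereal_minus_le_iff add.commute)
qed

text \<open>
  Every term of the supremum for \<open>(l', m')\<close>, with point \<open>w'\<close>, is dominated by the term for
  \<open>(l, m)\<close> with a suitable point \<open>w\<close>. By \<open>norm_add_sq_div_le\<close>,
  \<open>\<parallel>v - w'\<parallel>\<^sup>2 / l' \<le> \<parallel>v - w\<parallel>\<^sup>2 / l + \<parallel>w - w'\<parallel>\<^sup>2 / (l' - l)\<close> for all \<open>v\<close>, so it suffices that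
  \<open>\<parallel>w - w'\<parallel>\<^sup>2 / (l' - l) + \<parallel>w - x\<parallel>\<^sup>2 / m \<le> \<parallel>w' - x\<parallel>\<^sup>2 / m'\<close>. The minimum over \<open>w\<close> of the left side
  is \<open>\<parallel>w' - x\<parallel>\<^sup>2 / (l' - l + m)\<close>, and the hypothesis on the differences says exactly that
  \<open>m' \<le> l' - l + m\<close>.
\<close>

lemma lasry_lions_mono:
  fixes h :: "'a::real_inner \<Rightarrow> ereal"
  assumes l: "0 < l" "0 < m" "l \<le> l'" and lm: "0 < m'" "l - m \<le> l' - m'"
  shows "lasry_lions l' m' h x \<le> lasry_lions l m h x"
  unfolding lasry_lions_eq_SUP[of l']
proof (rule SUP_least)
  fix w'
  define d where "d = l' - l"
  \<comment> \<open>the minimizer of \<open>\<parallel>w - w'\<parallel>\<^sup>2 / d + \<parallel>w - x\<parallel>\<^sup>2 / m\<close>; for \<open>d = 0\<close> it is \<open>w'\<close>\<close>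
  define w where "w = x + (m / (d + m)) *\<^sub>R (w' - x)"
  have d: "0 \<le> d" "m' \<le> d + m" "l' = l + d" using l lm by (auto simp: d_def)
  have dm: "0 < d + m" using d l by simp
  have ww': "w - w' = - (d / (d + m)) *\<^sub>R (w' - x)"
  proof -
    have "w - w' = (m / (d + m) - 1) *\<^sub>R (w' - x)"
      by (simp add: w_def scaleR_left_diff_distrib)
    also have "m / (d + m) - 1 = - (d / (d + m))"
      using dm by (simp add: field_simps)
    finally show ?thesis .
  qed
  have quad: "(norm (v - w'))\<^sup>2 / l' + (norm (w - x))\<^sup>2 / m
        \<le> (norm (v - w))\<^sup>2 / l + (norm (w' - x))\<^sup>2 / m'" for v
  proof -
    let ?N = "(norm (w' - x))\<^sup>2"
    have wx: "(norm (w - x))\<^sup>2 = (m / (d + m))\<^sup>2 * ?N"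
      by (simp add: w_def power_mult_distrib power_divide)
    have split: "(norm (v - w'))\<^sup>2 / l' \<le> (norm (v - w))\<^sup>2 / l + d / (d + m)\<^sup>2 * ?N"
    proof (cases "d = 0")
      case True
      then show ?thesis using ww' d by simp
    next
      case False
      with d have "0 < d" by simp
      from norm_add_sq_div_le[OF l(1) this, of "v - w" "w - w'"]
      have "(norm (v - w'))\<^sup>2 / l' \<le> (norm (v - w))\<^sup>2 / l + (norm (w - w'))\<^sup>2 / d"
        by (simp add: d(3))
      also have "(norm (w - w'))\<^sup>2 / d = d / (d + m)\<^sup>2 * ?N"
        using \<open>0 < d\<close>
        by (simp add: ww' power_mult_distrib power_divide power2_eq_square del: scaleR_minus_left)
      finally show ?thesis .
    qed
    have "(m / (d + m))\<^sup>2 * ?N / m = m / (d + m)\<^sup>2 * ?N"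
      using l by (simp add: power_divide power2_eq_square)
    then have "d / (d + m)\<^sup>2 * ?N + (m / (d + m))\<^sup>2 * ?N / m = (d + m) / (d + m)\<^sup>2 * ?N"
      by (simp only: add_divide_distrib distrib_right)
    also have "\<dots> = ?N / (d + m)"
      using dm by (simp add: power2_eq_square)
    also have "\<dots> \<le> ?N / m'"
      using d lm by (intro divide_left_mono) auto
    finally show ?thesis unfolding wx using split by linarith
  qed
  have "moreau_envelope l' h w' - ereal (1 / (2 * m') * (norm (w' - x))\<^sup>2)
      + ereal (1 / (2 * m) * (norm (w - x))\<^sup>2) \<le> moreau_envelope l h w"
    unfolding moreau_envelope_def[of l]
  proof (rule INF_greatest)
    fix v
    have *: "A - ereal p' + ereal p \<le> H + ereal q"
      if "A \<le> H + ereal q'" "q' + p \<le> q + p'" for A H :: ereal and p p' q q'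
      using that by (cases A; cases H) auto
    show "moreau_envelope l' h w' - ereal (1 / (2 * m') * (norm (w' - x))\<^sup>2)
      + ereal (1 / (2 * m) * (norm (w - x))\<^sup>2) \<le> h v + ereal (1 / (2 * l) * (norm (v - w))\<^sup>2)"
      by (rule *[OF moreau_envelope_le[of l' h w' v]]) (use quad[of v] in \<open>simp add: field_simps\<close>)
  qed
  then have "moreau_envelope l' h w' - ereal (1 / (2 * m') * (norm (w' - x))\<^sup>2)
      \<le> moreau_envelope l h w - ereal (1 / (2 * m) * (norm (w - x))\<^sup>2)"
    by (simp add: ereal_le_minus_iff)
  also have "\<dots> \<le> lasry_lions l m h x"
    unfolding lasry_lions_eq_SUP by (rule SUP_upper) simp
  finally show "moreau_envelope l' h w' - ereal (1 / (2 * m') * (norm (w' - x))\<^sup>2)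
      \<le> lasry_lions l m h x" .
qed

text \<open>
  The lower half of the epi-convergence \<open>h\<^sup>l \<rightarrow> h\<close> as \<open>l \<rightarrow> 0\<close>. The points of the infimum are
  split by their distance to \<open>X k\<close>: within \<open>\<delta> / 2\<close> lower semicontinuity of \<open>h\<close> at \<open>x\<close>
  suffices, beyond it the penalty dominates.
\<close>

lemma eventually_le_moreau_envelope:
  fixes h :: "'a::real_inner \<Rightarrow> ereal"
  assumes lsc: "lower_semicontinuous h" and "prox_bounded h"
    and X: "(X \<longlongrightarrow> x) F" and l: "(l \<longlongrightarrow> 0) F" "\<forall>\<^sub>F k in F. 0 < l k"
    and a: "ereal a < h x"
  shows "\<forall>\<^sub>F k in F. ereal a \<le> moreau_envelope (l k) h (X k)"
proof -
  obtain \<gamma> m where \<gamma>: "0 < \<gamma>"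
    and m: "\<And>w. ereal m \<le> h w + ereal (1 / (2 * \<gamma>) * (norm w)\<^sup>2)"
    using \<open>prox_bounded h\<close> unfolding prox_bounded_def prox_bounded_with_def by blast
  have "h x \<le> Liminf (at x) h"
    using lsc unfolding lower_semicontinuous_def by blast
  with a have "ereal a < Liminf (at x) h"
    by (rule less_le_trans)
  then have "\<forall>\<^sub>F w in at x. ereal a < h w"
    by (rule less_LiminfD)
  then have "\<forall>\<^sub>F w in nhds x. ereal a < h w"
    using a by (auto simp: eventually_at_filter elim: eventually_mono)
  then obtain \<delta> where \<delta>: "0 < \<delta>" and near: "\<And>w. dist w x < \<delta> \<Longrightarrow> ereal a < h w"
    unfolding eventually_nhds_metric by blast
  \<comment> \<open>\<open>R\<close> bounds the squared norm of \<open>X k\<close> eventually. Of the penalty coefficient, the part \<open>1 / \<gamma>\<close>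
    pays for the quadratic minorant, and \<open>K\<close> is what then lifts the value above \<open>a\<close> at
    distance at least \<open>\<delta> / 2\<close>.\<close>
  define R where "R = (norm x + 1)\<^sup>2"
  define K where "K = max 0 ((a - m + R / \<gamma>) / (\<delta> / 2)\<^sup>2)"
  have K: "0 \<le> K" "a - m + R / \<gamma> \<le> K * (\<delta> / 2)\<^sup>2"
    using \<delta> by (auto simp: K_def field_simps le_max_iff_disj max_def)
  have C: "0 < K + 1 / \<gamma>" using K \<gamma> by (simp add: add_nonneg_pos)
  have "\<forall>\<^sub>F k in F. dist (X k) x < min 1 (\<delta> / 2)"
    using \<delta> by (intro tendstoD[OF X]) simp
  moreover have "\<forall>\<^sub>F k in F. l k < 1 / (2 * (K + 1 / \<gamma>))"
    using C by (intro order_tendstoD(2)[OF l(1)]) simp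
  ultimately show ?thesis
    using l(2)
  proof eventually_elim
    case (elim k)
    have "norm (X k) \<le> norm x + 1"
      using elim(1) norm_triangle_sub[of "X k" x] by (simp add: dist_norm)
    then have R: "(norm (X k))\<^sup>2 \<le> R"
      unfolding R_def by (rule power_mono) simp
    have Kl: "K + 1 / \<gamma> \<le> 1 / (2 * l k)"
      using elim(2,3) C by (simp add: field_simps)
    show ?case
      unfolding moreau_envelope_def
    proof (rule INF_greatest)
      fix w
      let ?q = "(norm (w - X k))\<^sup>2"
      show "ereal a \<le> h w + ereal (1 / (2 * l k) * ?q)"
      proof (cases "norm (w - X k) < \<delta> / 2")
        case True
        then have "dist w x < \<delta>"
          using elim(1) dist_triangle[of w x "X k"] by (simp add: dist_norm)
        then have "ereal a \<le> h w" using near by force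
        also have "\<dots> \<le> h w + ereal (1 / (2 * l k) * ?q)"
          using elim(3) by (intro ereal_le_add_self) simp
        finally show ?thesis .
      next
        case False
        have half: "1 / (2 * \<gamma>) * (norm w)\<^sup>2 \<le> ?q / \<gamma> + (norm (X k))\<^sup>2 / \<gamma>"
          using norm_add_sq_div_le[OF \<gamma> \<gamma>, of "w - X k" "X k"] by simp
        have Rg: "(norm (X k))\<^sup>2 / \<gamma> \<le> R / \<gamma>"
          using R \<gamma> by (intro divide_right_mono) auto
        have "(\<delta> / 2)\<^sup>2 \<le> ?q"
          using False \<delta> by (intro power_mono) auto
        then have "K * (\<delta> / 2)\<^sup>2 \<le> K * ?q"
          using K by (intro mult_left_mono)
        moreover have "(K + 1 / \<gamma>) * ?q \<le> 1 / (2 * l k) * ?q"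
          using Kl by (intro mult_right_mono) auto
        then have "K * ?q + ?q / \<gamma> \<le> 1 / (2 * l k) * ?q"
          by (simp add: distrib_right)
        ultimately have "a + 1 / (2 * \<gamma>) * (norm w)\<^sup>2 \<le> m + 1 / (2 * l k) * ?q"
          using half K(2) Rg by linarith
        with m[of w] show ?thesis
          by (cases "h w") auto
      qed
    qed
  qed
qed

lemma eventually_less_add_ereal:
  fixes c :: ereal
  assumes "(u \<longlongrightarrow> u0) F" "b < c + ereal u0"
  shows "\<forall>\<^sub>F k in F. b < c + ereal (u k)"
proof -
  have "((\<lambda>k. c + ereal (u k)) \<longlongrightarrow> c + ereal u0) F"
    using assms(1) by (cases c) (auto intro!: tendsto_intros)
  then show ?thesis using assms(2) by (rule order_tendstoD)
qed

text \<open>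
  Lower semicontinuity of \<open>g\<close> plus the double envelope, as a supremum over \<open>w\<close> of
  functions of \<open>x\<close> that are continuous even where the constant \<open>moreau_envelope l h w\<close> is
  infinite.
\<close>

lemma eventually_less_add_lasry_lions:
  fixes h :: "'a::real_inner \<Rightarrow> ereal"
  assumes g: "isCont g x" and X: "(X \<longlongrightarrow> x) F"
    and a: "a < ereal (g x) + lasry_lions l m h x"
  shows "\<forall>\<^sub>F k in F. a < ereal (g (X k)) + lasry_lions l m h (X k)"
proof -
  have eq: "ereal (g y) + (c - ereal q) = c + ereal (g y - q)" for y c q
    by (cases c) auto
  have sup: "ereal (g y) + lasry_lions l m h y =
      (SUP w. moreau_envelope l h w + ereal (g y - 1 / (2 * m) * (norm (w - y))\<^sup>2))" for y
    unfolding lasry_lions_eq_SUP eq[symmetric] by (simp add: SUP_ereal_add_right)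
  obtain w where w: "a < moreau_envelope l h w + ereal (g x - 1 / (2 * m) * (norm (w - x))\<^sup>2)"
    using a unfolding sup less_SUP_iff by blast
  have "((\<lambda>k. g (X k) - 1 / (2 * m) * (norm (w - X k))\<^sup>2)
      \<longlongrightarrow> g x - 1 / (2 * m) * (norm (w - x))\<^sup>2) F"
    by (intro tendsto_intros X isCont_tendsto_compose[OF g X])
  from eventually_less_add_ereal[OF this w] show ?thesis
    unfolding sup less_SUP_iff by (rule eventually_mono) blast
qed

section \<open>Variational convergence\<close>

lemma argmin_iff: "x \<in> argmin f \<longleftrightarrow> f x = (INF y. f y)" for f :: "'a \<Rightarrow> ereal"
proof -
  have "x \<in> argmin f \<longleftrightarrow> (\<forall>y. f x \<le> f y)"
    by (auto simp: argmin_def is_arg_min_def not_less)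
  also have "\<dots> \<longleftrightarrow> f x \<le> (INF y. f y)"
    by (auto simp: le_INF_iff)
  also have "\<dots> \<longleftrightarrow> f x = (INF y. f y)"
    using INF_lower[of x UNIV f] by auto
  finally show ?thesis .
qed

text \<open>
  The lower half of sequential epi-convergence of \<open>f\<close> to \<open>F\<close>, written without lower limits.
  The index map \<open>r\<close> is there because cluster points are limits of subsequences \<open>X \<circ> r\<close>
  whose terms are measured by \<open>f (r k)\<close>. For a constant sequence of functions equal to \<open>F\<close> this is
  sequential lower semicontinuity of \<open>F\<close>.
\<close>

definition liminf_inequality ::
  "(nat \<Rightarrow> 'a::topological_space \<Rightarrow> ereal) \<Rightarrow> ('a \<Rightarrow> ereal) \<Rightarrow> bool" where
  "liminf_inequality f F \<longleftrightarrow> (\<forall>r Y y a. strict_mono r \<longrightarrow> Y \<longlonglongrightarrow> y \<longrightarrow> a < F y \<longrightarrow>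
     (\<forall>\<^sub>F k in sequentially. a < f (r k) (Y k)))"

lemma liminf_inequalityD:
  assumes "liminf_inequality f F" "strict_mono r" "Y \<longlonglongrightarrow> y" "a < F y"
  shows "\<forall>\<^sub>F k in sequentially. a < f (r k) (Y k)"
  using assms unfolding liminf_inequality_def by blast

text \<open>
  The direct method for a varying objective. The common minorant \<open>B\<close> traps the sequence in
  one bounded sublevel set, so every subsequence has a convergent subsequence, and the liminf
  inequality at its limit bounds the values \<open>f k (X k)\<close> from below.
\<close>

lemma minimizing_sequence:
  fixes F :: "'a::heine_borel \<Rightarrow> ereal"
  assumes lower: "liminf_inequality f F"
    and lev: "level_bounded B" "\<forall>\<^sub>F k in sequentially. \<forall>x. B x \<le> f k x"
    and fin: "(INF x. F x) < \<infinity>"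
    and upper: "\<forall>b > INF x. F x. \<forall>\<^sub>F k in sequentially. f k (X k) < b"
  shows "bounded (range X)"
    and "seq_cluster_point X x \<Longrightarrow> x \<in> argmin F"
    and "(\<lambda>k. f k (X k)) \<longlonglongrightarrow> (INF x. F x)"
proof -
  let ?m = "INF x. F x"
  show bdd: "bounded (range X)"
  proof -
    obtain \<alpha> :: real where "?m < ereal \<alpha>"
      using ereal_dense2[OF fin] by blast
    from upper[rule_format, OF this] lev(2) have "\<forall>\<^sub>F k in sequentially. B (X k) \<le> ereal \<alpha>"
      by eventually_elim (meson less_imp_le order_trans)
    then obtain N where N: "\<And>k. k \<ge> N \<Longrightarrow> B (X k) \<le> ereal \<alpha>"
      unfolding eventually_sequentially by blast
    have "X k \<in> X ` {..<N} \<union> {x. B x \<le> ereal \<alpha>}" for k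
      using N[of k] by (cases "k < N") auto
    then have "range X \<subseteq> X ` {..<N} \<union> {x. B x \<le> ereal \<alpha>}"
      by blast
    moreover have "bounded (X ` {..<N} \<union> {x. B x \<le> ereal \<alpha>})"
      using lev(1) by (auto simp: level_bounded_def intro: finite_imp_bounded)
    ultimately show ?thesis by (rule bounded_subset[rotated])
  qed
  show "x \<in> argmin F" if cluster: "seq_cluster_point X x"
  proof -
    obtain r :: "nat \<Rightarrow> nat" where r: "strict_mono r" "(X \<circ> r) \<longlonglongrightarrow> x"
      using cluster unfolding seq_cluster_point_def by blast
    have "\<not> ?m < F x"
    proof
      assume "?m < F x"
      then obtain b where b: "?m < b" "b < F x" using dense by blast
      have "\<forall>\<^sub>F k in sequentially. f (r k) (X (r k)) < b"
        using eventually_subseq[OF r(1) upper[rule_format, OF b(1)]] .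
      moreover have "\<forall>\<^sub>F k in sequentially. b < f (r k) (X (r k))"
        using liminf_inequalityD[OF lower r b(2)] by simp
      ultimately have "\<forall>\<^sub>F k :: nat in sequentially. False"
        by eventually_elim simp
      then show False by simp
    qed
    then show ?thesis
      using INF_lower[of x UNIV F] by (auto simp: argmin_iff not_less)
  qed
  show "(\<lambda>k. f k (X k)) \<longlonglongrightarrow> ?m"
  proof (rule order_tendstoI)
    fix a assume a: "a < ?m"
    show "\<forall>\<^sub>F k in sequentially. a < f k (X k)"
    proof (rule ccontr)
      assume "\<not> ?thesis"
      then have "\<exists>\<^sub>\<infinity>k. \<not> a < f k (X k)"
        by (simp add: frequently_def cofinite_eq_sequentially)
      then have inf: "infinite {k. \<not> a < f k (X k)}"
        by (simp add: frequently_cofinite)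
      then obtain r :: "nat \<Rightarrow> nat" where r: "strict_mono r" "\<And>k. \<not> a < f (r k) (X (r k))"
        using infinite_enumerate by blast
      have "bounded (range (X \<circ> r))"
        using bdd by (rule bounded_subset) auto
      then obtain y s where s: "strict_mono s" "((X \<circ> r) \<circ> s) \<longlonglongrightarrow> y"
        using bounded_imp_convergent_subsequence by blast
      have "a < F y"
        using a INF_lower[of y UNIV F] by simp
      from liminf_inequalityD[OF lower strict_mono_o[OF r(1) s(1)] s(2) this]
      have "\<forall>\<^sub>F k :: nat in sequentially. False"
        using r(2) by simp
      then show False by simp
    qed
  qed (rule upper[rule_format])
qed

text \<open>
  The direct method for a single function. Values along a sequence approach the infimum even if
  it is \<open>-\<infinity>\<close>, so no lower bound on \<open>f\<close> has to be established first.
\<close>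

lemma argmin_nonempty:
  fixes f :: "'a::heine_borel \<Rightarrow> ereal"
  assumes lower: "liminf_inequality (\<lambda>_. f) f"
    and lev: "level_bounded f" and fin: "(INF x. f x) < \<infinity>"
  shows "argmin f \<noteq> {}"
proof -
  obtain u where u: "\<And>n. u n \<in> range f" "u \<longlonglongrightarrow> (INF x. f x)"
    using Inf_as_limit[of "range f"] by auto
  then have "\<forall>n. \<exists>x. f x = u n" by (metis rangeE)
  then obtain X where X: "\<And>n. f (X n) = u n" by metis
  have upper: "\<forall>b > INF x. f x. \<forall>\<^sub>F k in sequentially. f (X k) < b"
    unfolding X using order_tendstoD(2)[OF u(2)] by blast
  have lev': "\<forall>\<^sub>F k :: nat in sequentially. \<forall>x. f x \<le> f x" by simp
  note min = minimizing_sequence[where f = "\<lambda>_. f", OF lower lev lev' fin upper]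
  obtain x r where "strict_mono (r :: nat \<Rightarrow> nat)" "(X \<circ> r) \<longlonglongrightarrow> x"
    using bounded_imp_convergent_subsequence[OF min(1)] by blast
  then have "x \<in> argmin f"
    using min(2) unfolding seq_cluster_point_def by blast
  then show ?thesis by blast
qed

theorem mainTheorem1:
  fixes g :: "real ^ 'n \<Rightarrow> real"
    and h :: "real ^ 'n \<Rightarrow> ereal"
    and \<phi> :: "real ^ 'n \<Rightarrow> ereal"
    and \<phi>env :: "real \<Rightarrow> real \<Rightarrow> real ^ 'n \<Rightarrow> ereal"
    and lambar mubar :: real
    and lam mu :: "nat \<Rightarrow> real"
  assumes "continuously_differentiable g"
    and "proper_fun h" and "lower_semicontinuous h" and "prox_bounded h"
    and \<phi>_def: "\<phi> = (\<lambda>x. ereal (g x) + h x)"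
    and "argmin \<phi> \<noteq> {}"
    and \<phi>env_def: "\<phi>env = (\<lambda>l m x. ereal (g x) + lasry_lions l m h x)"
    and "0 < mubar" and "mubar < lambar" and "ereal lambar < prox_threshold h"
    and "level_bounded (\<phi>env lambar mubar)"
    and "\<And>k. 0 < lam k" and "\<And>k. 0 < mu k"
    and "\<And>k. lam k \<le> lambar" and "\<And>k. mu k < lam k" and "\<And>k. mu k \<le> mubar"
    and "lam \<longlonglongrightarrow> 0"
    and "decseq (\<lambda>k. lam k - mu k)" and "(\<lambda>k. lam k - mu k) \<longlonglongrightarrow> 0"
  shows "((\<forall>\<^sub>F k in sequentially. argmin (\<phi>env (lam k) (mu k)) \<noteq> {}) \<and>
          (\<lambda>k. INF x. \<phi>env (lam k) (mu k) x) \<longlonglongrightarrow> (INF x. \<phi> x)) \<and>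
         (\<forall>\<epsilon> X. (\<forall>k. 0 \<le> \<epsilon> k) \<longrightarrow> \<epsilon> \<longlonglongrightarrow> 0 \<longrightarrow>
            (\<forall>k. X k \<in> eps_argmin (\<epsilon> k) (\<phi>env (lam k) (mu k))) \<longrightarrow>
            bounded (range X) \<and> (\<forall>x. seq_cluster_point X x \<longrightarrow> x \<in> argmin \<phi>))"
proof -
  let ?f = "\<lambda>k. \<phi>env (lam k) (mu k)"
  let ?m = "INF x. \<phi> x"
  note lam_pos = \<open>\<And>k. 0 < lam k\<close> and mu_pos = \<open>\<And>k. 0 < mu k\<close> and mu_less = \<open>\<And>k. mu k < lam k\<close>
  have cont: "isCont g x" for x
    using \<open>continuously_differentiable g\<close>
    by (auto simp: continuously_differentiable_def intro: has_derivative_continuous)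

  have "?m < \<infinity>"
  proof -
    obtain x where "h x \<noteq> \<infinity>" using \<open>proper_fun h\<close> by (auto simp: proper_fun_def)
    then have "\<phi> x < \<infinity>" by (cases "h x") (auto simp: \<phi>_def)
    then show ?thesis by (rule le_less_trans[OF INF_lower[OF UNIV_I]])
  qed
  moreover have "?m \<noteq> -\<infinity>"
  proof -
    obtain x where "\<phi> x = ?m" using \<open>argmin \<phi> \<noteq> {}\<close> by (auto simp: argmin_iff)
    moreover have "\<phi> x \<noteq> -\<infinity>"
      using \<open>proper_fun h\<close> by (cases "h x") (auto simp: \<phi>_def proper_fun_def)
    ultimately show ?thesis by simp
  qed
  ultimately obtain c where c: "?m = ereal c"
    by (cases ?m) auto
  have fin: "?m < \<infinity>" by fact

  have le: "?f k x \<le> \<phi> x" for k x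
    unfolding \<phi>_def \<phi>env_def
    by (intro add_left_mono lasry_lions_le mu_pos mu_less)
  have Inf_le: "(INF x. ?f k x) \<le> ?m" for k
    by (intro INF_mono) (use le in blast)

  have "\<forall>\<^sub>F k in sequentially. lam k - mu k < lambar - mubar"
    using \<open>(\<lambda>k. lam k - mu k) \<longlonglongrightarrow> 0\<close> \<open>mubar < lambar\<close>
    by (intro order_tendstoD(2)) auto
  then have below: "\<forall>\<^sub>F k in sequentially. \<forall>x. \<phi>env lambar mubar x \<le> ?f k x"
  proof eventually_elim
    case (elim k)
    then show ?case
      unfolding \<phi>env_def
      by (intro allI add_left_mono lasry_lions_mono lam_pos mu_pos \<open>\<And>k. lam k \<le> lambar\<close> \<open>0 < mubar\<close>) simp
  qed

  have lower: "liminf_inequality ?f \<phi>"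
    unfolding liminf_inequality_def
  proof (intro allI impI)
    fix r :: "nat \<Rightarrow> nat" and Y y a
    assume r: "strict_mono r" and Y: "Y \<longlonglongrightarrow> y" and a: "a < \<phi> y"
    \<comment> \<open>a real level \<open>b\<close> for \<open>h\<close> separates the limit of the envelopes from that of \<open>g\<close>\<close>
    have "a - ereal (g y) < h y"
      using a by (simp add: \<phi>_def ereal_minus_less_iff add.commute)
    then obtain b where b: "a - ereal (g y) < ereal b" "ereal b < h y"
      using ereal_dense2 by blast
    have lr: "(\<lambda>k. lam (r k)) \<longlonglongrightarrow> 0"
      using LIMSEQ_subseq_LIMSEQ[OF \<open>lam \<longlonglongrightarrow> 0\<close> r] by (simp add: o_def)
    have "\<forall>\<^sub>F k in sequentially. ereal b \<le> moreau_envelope (lam (r k)) h (Y k)"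
      using \<open>lower_semicontinuous h\<close> \<open>prox_bounded h\<close> Y lr _ b(2)
      by (rule eventually_le_moreau_envelope) (simp add: lam_pos)
    moreover have "\<forall>\<^sub>F k in sequentially. a < ereal b + ereal (g (Y k))"
      by (rule eventually_less_add_ereal[OF isCont_tendsto_compose[OF cont Y]])
        (use b(1) in \<open>simp add: ereal_minus_less_iff add.commute\<close>)
    ultimately show "\<forall>\<^sub>F k in sequentially. a < ?f (r k) (Y k)"
    proof eventually_elim
      case (elim k)
      have "ereal b \<le> lasry_lions (lam (r k)) (mu (r k)) h (Y k)"
        using elim(1) moreau_envelope_le_lasry_lions by (rule order_trans)
      then have "ereal (g (Y k)) + ereal b \<le> ?f (r k) (Y k)"
        unfolding \<phi>env_def by (rule add_left_mono)
      with elim(2) show ?case by (simp add: add.commute)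
    qed
  qed

  note min = minimizing_sequence[where f = ?f and F = \<phi>,
      OF lower \<open>level_bounded (\<phi>env lambar mubar)\<close> below fin]

  have ne: "\<forall>\<^sub>F k in sequentially. argmin (?f k) \<noteq> {}"
    using below
  proof eventually_elim
    case (elim k)
    have "{x. ?f k x \<le> ereal \<alpha>} \<subseteq> {x. \<phi>env lambar mubar x \<le> ereal \<alpha>}" for \<alpha>
      using elim by (auto intro: order_trans)
    then have "level_bounded (?f k)"
      using \<open>level_bounded (\<phi>env lambar mubar)\<close>
      unfolding level_bounded_def by (blast intro: bounded_subset)
    moreover have "liminf_inequality (\<lambda>_. ?f k) (?f k)"
      unfolding liminf_inequality_def \<phi>env_def
      by (auto intro: eventually_less_add_lasry_lions[OF cont])
    moreover have "(INF x. ?f k x) < \<infinity>"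
      using Inf_le fin by (rule le_less_trans)
    ultimately show ?case by (intro argmin_nonempty)
  qed

  have "(\<lambda>k. INF x. ?f k x) \<longlonglongrightarrow> ?m"
  proof -
    define X where "X k = (SOME x. x \<in> argmin (?f k))" for k
    have eq: "\<forall>\<^sub>F k in sequentially. ?f k (X k) = (INF x. ?f k x)"
      using ne
    proof eventually_elim
      case (elim k)
      then have "X k \<in> argmin (?f k)"
        unfolding X_def by (simp add: some_in_eq)
      then show ?case by (simp add: argmin_iff)
    qed
    have "\<forall>\<^sub>F k in sequentially. ?f k (X k) < b" if "b > ?m" for b
      using eq
    proof eventually_elim
      case (elim k)
      then show ?case using le_less_trans[OF Inf_le that] by simp
    qed
    then have "(\<lambda>k. ?f k (X k)) \<longlonglongrightarrow> ?m" by (intro min(3)) blast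
    then show ?thesis by (rule Lim_transform_eventually[OF _ eq])
  qed
  moreover have "bounded (range X) \<and> (\<forall>x. seq_cluster_point X x \<longrightarrow> x \<in> argmin \<phi>)"
    if \<epsilon>: "\<epsilon> \<longlonglongrightarrow> 0" and X: "\<forall>k. X k \<in> eps_argmin (\<epsilon> k) (?f k)" for \<epsilon> X
  proof -
    have "\<forall>\<^sub>F k in sequentially. ?f k (X k) < b" if "b > ?m" for b
    proof -
      have "\<forall>\<^sub>F k in sequentially. ?m + ereal (\<epsilon> k) < b"
      proof (rule order_tendstoD)
        show "(\<lambda>k. ?m + ereal (\<epsilon> k)) \<longlonglongrightarrow> ?m"
          using tendsto_add[OF tendsto_const \<epsilon>, of c] by (simp add: c)
      qed fact
      then show ?thesis
      proof eventually_elim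
        case (elim k)
        have "?f k (X k) \<le> (INF x. ?f k x) + ereal (\<epsilon> k)"
          using X by (simp add: eps_argmin_def)
        also have "\<dots> \<le> ?m + ereal (\<epsilon> k)"
          by (intro add_right_mono Inf_le)
        finally show ?case using elim by simp
      qed
    qed
    then show ?thesis using min(1,2) by blast
  qed
  ultimately show ?thesis using ne by blast
qed

end
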